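(* There exists a polygon $P$ in the plane $\mathbb{R}^2$ that is the union of $4$ regular (equilateral) triangles with side length $1$ and for which the perimeter-to-area ratio satisfies $$\frac{p(P)}{a(P)} > 4\sqrt{3}$$ (where $4\sqrt{3}$ is the perimeter-to-area ratio of a single regular triangle with side length $1$).
   Context: Triangles are closed solid (filled) triangles in $\mathbb{R}^2$, in arbitrary position (arbitrary centre and rotation). A polygon is a closed region bounded by a simple closed polygonal chain. For a polygon $P$, $p(P)$ denotes its perimeter (length of its boundary) and $a(P)$ its area. *)

theory Defs
  imports "HOL-Analysis.Analysis"
begin

definition regular_triangle :: "real \<Rightarrow> (real^2) set \<Rightarrow> bool" where
  "regular_triangle s T \<longleftrightarrow> 0 < s \<and>
     (\<exists>a b c. dist a b = s \<and> dist b c = s \<and> dist c a = s \<and> T = convex hull {a, b, c})"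

(* The list gives the consecutive vertices of the chain; a closed chain repeats its first vertex
   at the end, as in [a, b, c, a].  The first two equations are junk values. *)
fun polygonal_chain :: "(real^2) list \<Rightarrow> real \<Rightarrow> real^2" where
  "polygonal_chain [] = linepath 0 0"
| "polygonal_chain [a] = linepath a a"
| "polygonal_chain [a, b] = linepath a b"
| "polygonal_chain (a # b # c # vs) = linepath a b +++ polygonal_chain (b # c # vs)"

definition chain_length :: "(real^2) list \<Rightarrow> real" where
  "chain_length vs = sum_list (map2 dist vs (tl vs))"

(* A constant path is not simple, nor is a segment traversed back and forth, so a simple closed
   chain has at least three distinct vertices and encloses a nonempty region. *)
definition simple_closed_chain :: "(real^2) list \<Rightarrow> bool" where
  "simple_closed_chain vs \<longleftrightarrow>
     simple_path (polygonal_chain vs) \<and>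
     pathfinish (polygonal_chain vs) = pathstart (polygonal_chain vs)"

(* The perimeter of such a P is chain_length vs: the chain is simple and closed, so it traverses
   the boundary of P exactly once. *)
definition polygon_with_boundary :: "(real^2) set \<Rightarrow> (real^2) list \<Rightarrow> bool" where
  "polygon_with_boundary P vs \<longleftrightarrow>
     simple_closed_chain vs \<and>
     P = path_image (polygonal_chain vs) \<union> inside (path_image (polygonal_chain vs))"

(* The value 4 * sqrt 3 is the ratio of a single regular triangle of side 1. *)
lemma regular_triangle_ratio:
  assumes "regular_triangle 1 T"
  shows "\<exists>vs. polygon_with_boundary T vs \<and> chain_length vs / measure lebesgue T = 4 * sqrt 3"
proof -
  obtain a b c where d: "dist a b = 1" "dist b c = 1" "dist c a = 1"
    and T: "T = convex hull {a, b, c}"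
    using assms by (auto simp: regular_triangle_def)
  have ne: "a \<noteq> b" "b \<noteq> c" "c \<noteq> a" using d by auto
  have "compact T" unfolding T by (simp add: finite_imp_compact_convex_hull)
  then have "measure lebesgue T = measure lborel T"
    by (simp add: compact_imp_closed measure_completion)
  also have "\<dots> = sqrt (3/2 * (3/2 - 1) * (3/2 - 1) * (3/2 - 1))"
    using heron[of a b c] d T by (simp add: dist_commute Let_def)
  also have "\<dots> = sqrt (3 * (1/4)^2)" by (simp add: power2_eq_square)
  also have "\<dots> = sqrt 3 / 4" by (simp add: real_sqrt_mult real_sqrt_divide)
  finally have area: "measure lebesgue T = sqrt 3 / 4" .
  have ncol: "\<not> collinear {a, b, c}"
    using d by (auto simp: collinear_between_cases between dist_commute)
  then have ncol': "\<not> collinear {b, c, a}" "\<not> collinear {c, a, b}"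
    by (simp_all add: insert_commute)
  have int: "closed_segment a b \<inter> closed_segment b c = {b}"
    "closed_segment b c \<inter> closed_segment c a = {c}"
    "closed_segment c a \<inter> closed_segment a b = {a}"
    using ncol ncol' by (simp_all add: Int_closed_segment)
  have arc: "arc (linepath b c +++ linepath c a)"
    using ne int by (intro arc_join) auto
  have "simple_path (linepath a b +++ linepath b c +++ linepath c a)"
    using ne int arc by (intro simple_path_join_loop) (auto simp: path_image_join)
  then have chain: "simple_closed_chain [a, b, c, a]"
    by (simp add: simple_closed_chain_def)
  have "path_image (polygonal_chain [a, b, c, a]) = frontier T"
    unfolding T by (subst frontier_of_triangle) (auto simp: path_image_join)
  moreover have "bounded T" "convex T" "closed T"
    using \<open>compact T\<close> by (simp_all add: compact_imp_bounded compact_imp_closed T)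
  moreover from this have "T = frontier T \<union> interior T"
    using interior_subset by (force simp: frontier_def)
  ultimately have "polygon_with_boundary T [a, b, c, a]"
    using chain by (simp add: polygon_with_boundary_def inside_frontier_eq_interior)
  moreover have "chain_length [a, b, c, a] / measure lebesgue T = 4 * sqrt 3"
    using d by (simp add: chain_length_def area field_simps)
  ultimately show ?thesis by blast
qed

end

theory Submission
  imports Defs
begin

text \<open>
  If several unit triangles have the same centre and inradius r, every edge line of the union has
  distance r from the centre, so the ratio of the union is 2/r = 4 sqrt 3, as for one triangle.
  A small translation of the triangles changes p - 4 sqrt 3 a only to second order. For the rotation
  angles 0, 30, 60, 90 degrees all reflex corners are right angles, and that second-order term is
  proportional to the signed area of the quadrilateral formed by the four translation vectors,
  hence can be made positive. This leads to the four images, under rotations by multiples of 90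
  degrees about the origin, of a triangle whose centre lies at distance sqrt 3 / 30 from the
  origin. Their union is a 24-gon, star-shaped about the origin, with perimeter 12 - 4 sqrt 3 and
  area sqrt 3 - 51/50.
\<close>

subsection \<open>Simple closed chains sorted by angle\<close>

text \<open>The determinant, twice the signed area of the triangle 0, \<open>a\<close>,
  \<open>b\<close>. It is positive iff \<open>b\<close> lies counterclockwise of \<open>a\<close> by
  an angle strictly between 0 and a half turn.\<close>

definition crs :: "real^2 \<Rightarrow> real^2 \<Rightarrow> real" where
  "crs a b = a$1 * b$2 - a$2 * b$1"

lemma crs_self [simp]: "crs a a = 0"
  by (simp add: crs_def)

lemma crs_commute: "crs b a = - crs a b"
  by (simp add: crs_def algebra_simps)

lemma crs_linear:
  "crs d (x + y) = crs d x + crs d y"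
  "crs d (r *\<^sub>R x) = r * crs d x"
  by (simp_all add: crs_def algebra_simps)

lemma convex_crs_pos: "convex {x. 0 < crs d x}"
  and convex_crs_nonneg: "convex {x. 0 \<le> crs d x}"
  and convex_crs_nonpos: "convex {x. crs d x \<le> 0}"
proof -
  have "linear (crs d)"
    by (rule linearI) (simp_all add: crs_linear)
  then have "convex (crs d -` {0<..})" "convex (crs d -` {0..})" "convex (crs d -` {..0})"
    by (intro convex_linear_vimage; simp)+
  then show "convex {x. 0 < crs d x}" "convex {x. 0 \<le> crs d x}" "convex {x. crs d x \<le> 0}"
    by (simp_all add: vimage_def)
qed

section \<open>Path images and arcs of polygonal chains\<close>

lemma pathstart_polygonal_chain: "vs \<noteq> [] \<Longrightarrow> pathstart (polygonal_chain vs) = hd vs"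
  by (induction vs rule: polygonal_chain.induct) auto

lemma pathfinish_polygonal_chain: "vs \<noteq> [] \<Longrightarrow> pathfinish (polygonal_chain vs) = last vs"
  by (induction vs rule: polygonal_chain.induct) auto

lemma path_image_polygonal_chain_Cons:
  "vs \<noteq> [] \<Longrightarrow> path_image (polygonal_chain (a # b # vs)) =
    closed_segment a b \<union> path_image (polygonal_chain (b # vs))"
  by (cases vs) (simp_all add: path_image_join pathstart_polygonal_chain)

lemma path_image_polygonal_chain:
  "2 \<le> length vs \<Longrightarrow> path_image (polygonal_chain vs) =
    (\<Union>(a, b)\<in>set (zip vs (tl vs)). closed_segment a b)"
proof (induction vs rule: polygonal_chain.induct)
  case (4 a b c vs)
  then show ?case
    by (simp add: path_image_polygonal_chain_Cons del: polygonal_chain.simps)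
qed auto

text \<open>Carries sign conditions of \<open>crs\<close> from the vertices to the whole chain,
  since half-planes are convex.\<close>

lemma path_image_polygonal_chain_subset_hull:
  "vs \<noteq> [] \<Longrightarrow> path_image (polygonal_chain vs) \<subseteq> convex hull set vs"
proof (induction vs rule: polygonal_chain.induct)
  case (4 a b c vs)
  have "closed_segment a b \<subseteq> convex hull set (a # b # c # vs)"
    by (simp add: segment_convex_hull hull_mono)
  moreover have "convex hull set (b # c # vs) \<subseteq> convex hull set (a # b # c # vs)"
    by (rule hull_mono) auto
  ultimately show ?case
    using 4 by (simp add: path_image_polygonal_chain_Cons del: polygonal_chain.simps)
qed (simp_all add: segment_convex_hull)

lemma path_image_polygonal_chain_append:
  assumes "xs \<noteq> []" "ys \<noteq> []"
  shows "path_image (polygonal_chain (xs @ m # ys)) =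
    path_image (polygonal_chain (xs @ [m])) \<union> path_image (polygonal_chain (m # ys))"
  using assms
proof (induction xs rule: list_nonempty_induct)
  case (single x)
  then show ?case by (simp add: path_image_polygonal_chain_Cons)
next
  case (cons x xs)
  obtain y zs where xs: "xs = y # zs"
    using cons.hyps by (cases xs) auto
  then show ?case
    using cons by (simp add: path_image_polygonal_chain_Cons Un_assoc)
qed

lemma arc_linepath_iff: "arc (linepath a b) \<longleftrightarrow> a \<noteq> b"
  using arc_distinct_ends[of "linepath a b"] by auto

text \<open>With \<open>vs = []\<close> the tail would be the constant path at \<open>b\<close>,
  which is not an arc, and the equivalence would fail.\<close>

lemma arc_polygonal_chain_Cons:
  assumes "vs \<noteq> []"
  shows "arc (polygonal_chain (a # b # vs)) \<longleftrightarrow> a \<noteq> b \<and> arc (polygonal_chain (b # vs)) \<and>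
    closed_segment a b \<inter> path_image (polygonal_chain (b # vs)) \<subseteq> {b}"
  using assms
  by (cases vs) (auto simp: arc_join_eq pathstart_polygonal_chain arc_linepath_iff)

lemma arc_polygonal_chain_append:
  assumes "xs \<noteq> []" "ys \<noteq> []"
    and "arc (polygonal_chain (xs @ [m]))" "arc (polygonal_chain (m # ys))"
    and "path_image (polygonal_chain (xs @ [m])) \<inter> path_image (polygonal_chain (m # ys)) \<subseteq> {m}"
  shows "arc (polygonal_chain (xs @ m # ys))"
  using assms
proof (induction xs rule: list_nonempty_induct)
  case (single x)
  then show ?case by (simp add: arc_polygonal_chain_Cons arc_linepath_iff)
next
  case (cons x xs)
  obtain y zs where xs: "xs = y # zs"
    using cons.hyps by (cases xs) auto
  have *: "x \<noteq> y" "arc (polygonal_chain (xs @ [m]))"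
    "closed_segment x y \<inter> path_image (polygonal_chain (xs @ [m])) \<subseteq> {y}"
    using cons.prems by (simp_all add: xs arc_polygonal_chain_Cons)
  have im: "path_image (polygonal_chain ((x # xs) @ [m])) =
      closed_segment x y \<union> path_image (polygonal_chain (xs @ [m]))"
    by (simp add: xs path_image_polygonal_chain_Cons)
  have arc: "arc (polygonal_chain (xs @ m # ys))"
    using cons.prems * im by (intro cons.IH) auto
  have m: "m \<in> path_image (polygonal_chain (xs @ [m]))"
    using pathfinish_in_path_image[of "polygonal_chain (xs @ [m])"]
    by (simp add: pathfinish_polygonal_chain)
  \<comment> \<open>A common point with the second part is \<open>m\<close>, which also lies on the
    first part, where the segment is met only in \<open>y\<close>.\<close>
  have "closed_segment x y \<inter> path_image (polygonal_chain (xs @ m # ys)) \<subseteq> {y}"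
    using * im m cons.prems by (subst path_image_polygonal_chain_append) (auto simp: xs)
  then show ?case
    using * arc by (simp add: xs arc_polygonal_chain_Cons)
qed

lemma segment_crs_zero:
  assumes "x \<in> closed_segment a b" "0 < crs a b" "0 \<le> crs b x"
  shows "x = b"
proof -
  obtain u where u: "0 \<le> u" "u \<le> 1" "x = (1 - u) *\<^sub>R a + u *\<^sub>R b"
    using assms(1) by (auto simp: in_segment)
  have "crs b x = - ((1 - u) * crs a b)"
    unfolding u(3) by (simp add: crs_linear crs_commute[of b a])
  with assms u(2) have "u = 1"
    by (auto simp: mult_le_0_iff)
  then show ?thesis using u by simp
qed

text \<open>\<open>sorted_wrt\<close> compares all pairs of vertices, not only neighbours, so the
  chain turns by less than a half turn and stays in the wedge from \<open>a\<close> counterclockwise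
  to \<open>last vs\<close>.\<close>

lemma crs_chain:
  assumes "sorted_wrt (\<lambda>a b. 0 < crs a b) (a # vs)" "vs \<noteq> []"
    and x: "x \<in> path_image (polygonal_chain (a # vs))"
  shows "0 \<le> crs a x" "crs (last vs) x \<le> 0"
proof -
  have x: "x \<in> convex hull set (a # vs)"
    using x path_image_polygonal_chain_subset_hull[of "a # vs"] by auto
  have "set (a # vs) \<subseteq> {x. 0 \<le> crs a x}"
    using assms(1) by (auto simp: less_imp_le)
  then have "convex hull set (a # vs) \<subseteq> {x. 0 \<le> crs a x}"
    by (intro hull_minimal convex_crs_nonneg)
  with x show "0 \<le> crs a x" by blast
  have "sorted_wrt (\<lambda>a b. 0 < crs a b) ((a # butlast vs) @ [last vs])"
    using assms by simp
  then have "\<forall>v\<in>set (a # butlast vs). 0 < crs v (last vs)"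
    unfolding sorted_wrt_append by auto
  moreover have "set (a # vs) = set (a # butlast vs) \<union> {last vs}"
    using assms(2) by (metis append_Cons append_butlast_last_id list.set(1) list.set(2) set_append)
  ultimately have "set (a # vs) \<subseteq> {x. crs (last vs) x \<le> 0}"
    by (auto simp: crs_commute[of "last vs"])
  then have "convex hull set (a # vs) \<subseteq> {x. crs (last vs) x \<le> 0}"
    by (intro hull_minimal convex_crs_nonpos)
  with x show "crs (last vs) x \<le> 0" by blast
qed

lemma crs_chain_tail_pos:
  assumes "sorted_wrt (\<lambda>a b. 0 < crs a b) (a # vs)" "vs \<noteq> []"
    and x: "x \<in> path_image (polygonal_chain vs)"
  shows "0 < crs a x"
proof -
  have "convex hull set vs \<subseteq> {x. 0 < crs a x}"
    using assms(1) by (intro hull_minimal convex_crs_pos) auto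
  with x path_image_polygonal_chain_subset_hull[OF assms(2)] show ?thesis by blast
qed

text \<open>From the second vertex on, the chain lies strictly to the left of the line through 0 and
  \<open>a\<close>; only the first edge can reach that line, and it does so only at
  \<open>a\<close>.\<close>

lemma crs_chain_zero:
  assumes vs: "sorted_wrt (\<lambda>a b. 0 < crs a b) (a # vs)" "vs \<noteq> []"
    and x: "x \<in> path_image (polygonal_chain (a # vs))" and z: "crs a x \<le> 0"
  shows "x = a"
proof -
  obtain b ws where b: "vs = b # ws"
    using vs(2) by (cases vs) auto
  have "x \<notin> path_image (polygonal_chain vs)"
    using crs_chain_tail_pos[OF vs] z by force
  then have "x \<in> closed_segment b a"
    using x by (cases "ws = []") (auto simp: b path_image_polygonal_chain_Cons closed_segment_commute)
  then obtain u where u: "0 \<le> u" "u \<le> 1" "x = (1 - u) *\<^sub>R b + u *\<^sub>R a"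
    by (auto simp: in_segment)
  have "(1 - u) * crs a b \<le> 0"
    using z unfolding u(3) by (simp add: crs_linear)
  then have "u = 1"
    using vs u by (auto simp: b mult_le_0_iff)
  then show ?thesis using u by simp
qed

text \<open>The line through 0 and \<open>b\<close> separates the edge ending in \<open>b\<close>
  from the rest of the chain, so they share only \<open>b\<close>.\<close>

lemma arc_crs_sorted:
  "sorted_wrt (\<lambda>a b. 0 < crs a b) vs \<Longrightarrow> 2 \<le> length vs \<Longrightarrow> arc (polygonal_chain vs)"
proof (induction vs rule: polygonal_chain.induct)
  case (3 a b)
  then have "a \<noteq> b" by auto
  then show ?case by simp
next
  case (4 a b c vs)
  then have "a \<noteq> b" by auto
  moreover have "closed_segment a b \<inter> path_image (polygonal_chain (b # c # vs)) \<subseteq> {b}"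
    using 4(2) segment_crs_zero crs_chain(1)[of b "c # vs"] by auto
  ultimately show ?case
    using 4 by (subst arc_polygonal_chain_Cons) auto
qed auto

text \<open>A pairwise sorted piece turns by less than a half turn, so two pieces could not close
  up. Three do: they occupy wedges that meet along the rays through \<open>a\<close>,
  \<open>b\<close>, \<open>c\<close>, which the pieces touch only at these vertices. The first edge
  is split off so that the loop is a join of two arcs.\<close>

lemma simple_closed_chain_crs_sorted:
  assumes "sorted_wrt (\<lambda>a b. 0 < crs a b) (a # a' # xs @ [b])"
    and "sorted_wrt (\<lambda>a b. 0 < crs a b) (b # ys @ [c])"
    and "sorted_wrt (\<lambda>a b. 0 < crs a b) (c # zs @ [a])"
  shows "simple_closed_chain (a # a' # xs @ b # ys @ c # zs @ [a])"
proof -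
  define X where "X = path_image (polygonal_chain (a' # xs @ [b]))"
  define Y where "Y = path_image (polygonal_chain (b # ys @ [c]))"
  define Z where "Z = path_image (polygonal_chain (c # zs @ [a]))"
  have aX: "closed_segment a a' \<union> X = path_image (polygonal_chain (a # a' # xs @ [b]))"
    by (simp add: X_def path_image_polygonal_chain_Cons)
  have pos: "0 < crs a x" if "x \<in> X" for x
    using crs_chain_tail_pos[OF assms(1)] that by (simp add: X_def)
  have AX: "0 \<le> crs a x" "crs b x \<le> 0" if "x \<in> closed_segment a a' \<union> X" for x
    using crs_chain[OF assms(1)] that by (simp_all add: aX)
  have BY: "0 \<le> crs b x" "crs c x \<le> 0" if "x \<in> Y" for x
    using crs_chain[OF assms(2)] that by (simp_all add: Y_def)
  have CZ: "0 \<le> crs c x" "crs a x \<le> 0" if "x \<in> Z" for x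
    using crs_chain[OF assms(3)] that by (simp_all add: Z_def)
  have eqa: "x = a" if "x \<in> closed_segment a a' \<union> X" "crs a x \<le> 0" for x
    using crs_chain_zero[OF assms(1)] that unfolding aX by blast
  have eqb: "x = b" if "x \<in> Y" "crs b x \<le> 0" for x
    using crs_chain_zero[OF assms(2)] that by (simp add: Y_def)
  have eqc: "x = c" if "x \<in> Z" "crs c x \<le> 0" for x
    using crs_chain_zero[OF assms(3)] that by (simp add: Z_def)
  have arc1: "arc (polygonal_chain (a # a' # xs @ [b]))"
    by (rule arc_crs_sorted) (use assms in auto)
  have arcZ: "arc (polygonal_chain (c # zs @ [a]))" and arcY: "arc (polygonal_chain (b # ys @ [c]))"
    using assms by (auto intro!: arc_crs_sorted)
  have YZ: "Y \<inter> Z \<subseteq> {c}"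
    using BY(2) eqc by blast
  have arcYZ: "arc (polygonal_chain (b # ys @ c # zs @ [a]))"
    using arc_polygonal_chain_append[of "b # ys" "zs @ [a]" c] arcY arcZ YZ
    by (simp add: Y_def Z_def)
  have imYZ: "path_image (polygonal_chain (b # ys @ c # zs @ [a])) = Y \<union> Z"
    using path_image_polygonal_chain_append[of "b # ys" "zs @ [a]" c] by (simp add: Y_def Z_def)
  \<comment> \<open>The sign of \<open>crs a\<close> keeps \<open>X\<close> apart from
    \<open>Z\<close>; the sign of \<open>crs b\<close> leaves only \<open>b\<close> in common with
    \<open>Y\<close>.\<close>
  have XYZ: "X \<inter> (Y \<union> Z) \<subseteq> {b}"
    using pos AX eqb CZ by force
  have arcX: "a \<noteq> a'" "arc (polygonal_chain (a' # xs @ [b]))" "closed_segment a a' \<inter> X \<subseteq> {a'}"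
    using arc1 by (simp_all add: arc_polygonal_chain_Cons X_def)
  have arcXYZ: "arc (polygonal_chain (a' # xs @ b # ys @ c # zs @ [a]))"
    using arc_polygonal_chain_append[of "a' # xs" "ys @ c # zs @ [a]" b] arcX arcYZ XYZ
    by (simp add: X_def imYZ)
  have imXYZ: "path_image (polygonal_chain (a' # xs @ b # ys @ c # zs @ [a])) = X \<union> Y \<union> Z"
    using path_image_polygonal_chain_append[of "a' # xs" "ys @ c # zs @ [a]" b]
    by (simp add: X_def imYZ Un_assoc)
  have "b \<in> X"
    using pathfinish_in_path_image[of "polygonal_chain (a' # xs @ [b])"]
    by (simp add: X_def pathfinish_polygonal_chain)
  \<comment> \<open>A common point with \<open>Z\<close> is \<open>a\<close>. A common point with
    \<open>Y\<close> is \<open>b\<close>, which lies in \<open>X\<close>, and there the segment is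
    met only in \<open>a'\<close>.\<close>
  then have "closed_segment a a' \<inter> (X \<union> Y \<union> Z) \<subseteq> {a, a'}"
    using arcX(3) AX(2) eqb CZ(2) eqa by blast
  then have "simple_path (linepath a a' +++ polygonal_chain (a' # xs @ b # ys @ c # zs @ [a]))"
    using arcX(1) arcXYZ imXYZ
    by (intro simple_path_join_loop) (auto simp: pathstart_polygonal_chain pathfinish_polygonal_chain)
  moreover have "polygonal_chain (a # a' # xs @ b # ys @ c # zs @ [a]) =
      linepath a a' +++ polygonal_chain (a' # xs @ b # ys @ c # zs @ [a])"
    by (cases xs) auto
  ultimately show ?thesis
    by (simp add: simple_closed_chain_def pathstart_polygonal_chain pathfinish_polygonal_chain)
qed

subsection \<open>Regions star-shaped about the origin\<close>

text \<open>A discrete intermediate value theorem on a cycle: without such a step, \<open>f\<close>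
  stays positive once it is nonnegative, and going past the end back to the start makes it positive
  everywhere.\<close>

lemma sign_change_zip:
  fixes f :: "'a \<Rightarrow> real"
  assumes "hd vs = last vs" "u \<in> set vs" "0 \<le> f u" "w \<in> set vs" "f w \<le> 0" "2 \<le> length vs"
  shows "\<exists>(p, q)\<in>set (zip vs (tl vs)). 0 \<le> f p \<and> f q \<le> 0"
proof (rule ccontr)
  assume "\<not> ?thesis"
  then have step: "0 < f (vs ! Suc i)" if "Suc i < length vs" "0 \<le> f (vs ! i)" for i
    using that by (force simp: set_zip nth_tl)
  have up: "0 < f (vs ! j)" if "i < j" "j < length vs" "0 \<le> f (vs ! i)" for i j
    using that
  proof (induction j)
    case (Suc j)
    then show ?case
      using step[of j] by (cases "i = j") auto
  qed simp
  obtain i k where ik: "i < length vs" "vs ! i = u" "k < length vs" "vs ! k = w"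
    using assms by (metis in_set_conv_nth)
  have ends: "vs ! 0 = vs ! (length vs - 1)"
    using assms(1,6) by (metis hd_conv_nth last_conv_nth list.size(3) not_numeral_le_zero)
  have "0 \<le> f (vs ! (length vs - 1))"
    using up[of i "length vs - 1"] ik assms(3)
    by (cases "i = length vs - 1") (auto simp: less_imp_le)
  then have pos: "0 < f (vs ! j)" if "0 < j" "j < length vs" for j
    using up[of 0 j] ends that by simp
  moreover have "0 < f (vs ! 0)"
    using pos[of "length vs - 1"] assms(6) ends by simp
  ultimately have "0 < f (vs ! k)"
    using ik by (cases k) auto
  with assms(5) ik show False by simp
qed

lemma ray_meets_segment:
  assumes "0 < crs p q" "0 \<le> crs p x" "crs q x \<le> 0" "x \<noteq> 0"
  obtains t where "0 < t" "t *\<^sub>R x \<in> closed_segment p q"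
proof
  define s where "s = crs p x - crs q x"
  \<comment> \<open>Cramer's rule. Both coefficients are nonnegative, and dividing by their sum
    \<open>s\<close> gives a convex combination of \<open>p\<close> and \<open>q\<close>.\<close>
  have eq: "crs p q *\<^sub>R x = (- crs q x) *\<^sub>R p + crs p x *\<^sub>R q"
    by (simp add: crs_def vec_eq_iff forall_2 algebra_simps)
  have "crs p q *\<^sub>R x \<noteq> 0"
    using assms by simp
  then have "s \<noteq> 0"
    using assms unfolding eq s_def by (auto simp: add_nonneg_eq_0_iff)
  then have "0 < s"
    using assms by (simp add: s_def)
  then show "0 < crs p q / s"
    using assms by simp
  have "(crs p q / s) *\<^sub>R x = (1 / s) *\<^sub>R (crs p q *\<^sub>R x)"
    by simp
  also have "\<dots> = (- crs q x / s) *\<^sub>R p + (crs p x / s) *\<^sub>R q"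
    unfolding eq by (simp add: scaleR_diff_right divide_inverse mult.commute)
  also have "- crs q x / s = 1 - crs p x / s"
    using \<open>0 < s\<close> by (simp add: s_def field_simps)
  finally show "(crs p q / s) *\<^sub>R x \<in> closed_segment p q"
    using \<open>0 < s\<close> assms unfolding in_segment
    by (intro exI[of _ "crs p x / s"]) (simp add: s_def)
qed

text \<open>Replaces convexity by radial shrinking. A component of the complement of the frontier
  that starts in the interior cannot leave the bounded set \<open>P\<close>; a point outside
  \<open>P\<close> escapes to infinity along its ray.\<close>

lemma inside_frontier_eq_interior_if_radial:
  fixes P :: "'a::euclidean_space set"
  assumes "compact P" "P \<noteq> {}"
    and int: "\<And>x t. \<lbrakk>x \<in> P; 0 \<le> t; t < 1\<rbrakk> \<Longrightarrow> t *\<^sub>R x \<in> interior P"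
  shows "inside (frontier P) = interior P"
proof (intro equalityI subsetI)
  fix x assume "x \<in> interior P"
  then have xP: "x \<in> P" "x \<notin> frontier P"
    using interior_subset by (auto simp: frontier_def)
  let ?C = "connected_component_set (- frontier P) x"
  have "?C \<subseteq> P"
  proof (rule ccontr)
    assume "\<not> ?C \<subseteq> P"
    moreover have "x \<in> ?C" using xP by simp
    ultimately have "?C \<inter> frontier P \<noteq> {}"
      using xP by (intro connected_Int_frontier) (blast intro: connected_connected_component)+
    then show False
      using connected_component_subset[of "- frontier P" x] by auto
  qed
  then show "x \<in> inside (frontier P)"
    using xP compact_imp_bounded[OF assms(1)] bounded_subset by (auto simp: inside_def)
next
  fix x assume x: "x \<in> inside (frontier P)"
  show "x \<in> interior P"
  proof (rule ccontr)
    assume "x \<notin> interior P"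
    moreover have "x \<notin> frontier P"
      using x by (simp add: inside_def)
    ultimately have "x \<notin> P"
      using closure_subset by (auto simp: frontier_def)
    obtain y where "y \<in> P" using assms(2) by auto
    then have 0: "0 \<in> interior P"
      using int[of y 0] by simp
    have "x \<noteq> 0"
      using 0 \<open>x \<notin> interior P\<close> by auto
    define R where "R = (\<lambda>t. t *\<^sub>R x) ` {1..}"
    have out: "t *\<^sub>R x \<notin> P" if "1 \<le> t" for t
    proof
      assume "t *\<^sub>R x \<in> P"
      moreover have "t \<noteq> 1"
        using \<open>x \<notin> P\<close> \<open>t *\<^sub>R x \<in> P\<close> by auto
      ultimately have "(1 / t) *\<^sub>R (t *\<^sub>R x) \<in> interior P"
        using that by (intro int) auto
      then show False
        using that \<open>x \<notin> interior P\<close> by simp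
    qed
    have "connected R"
      unfolding R_def by (intro connected_continuous_image continuous_intros) simp
    moreover have "R \<inter> frontier P = {}"
      using out compact_imp_closed[OF assms(1)] by (auto simp: R_def frontier_def)
    moreover have "x \<in> R"
      unfolding R_def by (rule image_eqI[of _ _ 1]) auto
    ultimately have sub: "R \<subseteq> connected_component_set (- frontier P) x"
      by (intro connected_component_maximal) auto
    have "\<not> bounded R"
    proof
      assume "bounded R"
      then obtain B where B: "\<And>y. y \<in> R \<Longrightarrow> norm y \<le> B"
        by (auto simp: bounded_iff)
      define t where "t = 1 + \<bar>B\<bar> / norm x"
      have "t *\<^sub>R x \<in> R"
        by (auto simp: R_def t_def)
      then have "t * norm x \<le> B"
        using B[of "t *\<^sub>R x"] by (auto simp: t_def)
      moreover have "t * norm x = norm x + \<bar>B\<bar>"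
        using \<open>x \<noteq> 0\<close> by (simp add: t_def field_simps)
      moreover have "0 < norm x"
        using \<open>x \<noteq> 0\<close> by simp
      ultimately show False by linarith
    qed
    moreover have "bounded (connected_component_set (- frontier P) x)"
      using x by (simp add: inside_def)
    ultimately show False
      using sub bounded_subset by blast
  qed
qed

text \<open>The chain is the frontier: a chain point is not interior, as pushing it outward leaves
  \<open>P\<close>. Conversely the ray of a frontier point \<open>x\<close> meets the chain at some
  multiple \<open>t\<close> of \<open>x\<close>, where \<open>t < 1\<close> contradicts
  \<open>out\<close> and \<open>t > 1\<close> contradicts \<open>int\<close>.\<close>

lemma polygon_with_boundary_if_radial:
  assumes "compact P" and chain: "simple_closed_chain vs"
    and int: "\<And>x t. \<lbrakk>x \<in> P; 0 \<le> t; t < 1\<rbrakk> \<Longrightarrow> t *\<^sub>R x \<in> interior P"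
    and sub: "path_image (polygonal_chain vs) \<subseteq> P"
    and out: "\<And>x t. \<lbrakk>x \<in> path_image (polygonal_chain vs); 1 < t\<rbrakk> \<Longrightarrow> t *\<^sub>R x \<notin> P"
    and ray: "\<And>x. x \<noteq> 0 \<Longrightarrow> \<exists>t>0. t *\<^sub>R x \<in> path_image (polygonal_chain vs)"
  shows "polygon_with_boundary P vs"
proof -
  let ?C = "path_image (polygonal_chain vs)"
  obtain y where "y \<in> ?C" using path_image_nonempty by blast
  then have ne: "P \<noteq> {}" and 0: "0 \<in> interior P"
    using sub int[of y 0] by auto
  have fr: "frontier P = P - interior P"
    using compact_imp_closed[OF assms(1)] by (simp add: frontier_def)
  have "?C = frontier P"
  proof (intro equalityI subsetI)
    fix x assume x: "x \<in> ?C"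
    have "x \<notin> interior P"
    proof
      assume "x \<in> interior P"
      moreover have "((\<lambda>t. t *\<^sub>R x) \<longlongrightarrow> 1 *\<^sub>R x) (at_right 1)"
        by (intro tendsto_intros)
      ultimately have "eventually (\<lambda>t. t *\<^sub>R x \<in> interior P) (at_right 1)"
        by (intro topological_tendstoD) auto
      then have "eventually (\<lambda>t. t *\<^sub>R x \<in> interior P \<and> 1 < t) (at_right (1::real))"
        using eventually_at_right_less by (rule eventually_conj)
      then obtain t where "t *\<^sub>R x \<in> interior P" "1 < t"
        using eventually_happens'[OF trivial_limit_at_right_real] by blast
      then show False
        using out[OF x] interior_subset by blast
    qed
    then show "x \<in> frontier P"
      using x sub fr by auto
  next
    fix x assume x: "x \<in> frontier P"
    then have "x \<noteq> 0" using 0 fr by auto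
    then obtain t where t: "0 < t" "t *\<^sub>R x \<in> ?C"
      using ray by blast
    have "\<not> t < 1"
      using out[OF t(2), of "1 / t"] t(1) x fr by auto
    moreover have "\<not> 1 < t"
      using int[of "t *\<^sub>R x" "1 / t"] t sub x fr by auto
    ultimately have "t = 1" by simp
    then show "x \<in> ?C" using t by simp
  qed
  then show ?thesis
    using chain inside_frontier_eq_interior_if_radial[OF assms(1) ne int] fr interior_subset[of P]
    by (auto simp: polygon_with_boundary_def)
qed

section \<open>Bounding the area by a fan of triangles with apex at the origin\<close>

lemma radial_subset_fan:
  assumes len: "2 \<le> length vs"
    and out: "\<And>x t. \<lbrakk>x \<in> path_image (polygonal_chain vs); 1 < t\<rbrakk> \<Longrightarrow> t *\<^sub>R x \<notin> P"
    and ray: "\<And>x. x \<noteq> 0 \<Longrightarrow> \<exists>t>0. t *\<^sub>R x \<in> path_image (polygonal_chain vs)"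
  shows "P \<subseteq> (\<Union>(a, b)\<in>set (zip vs (tl vs)). convex hull {0, a, b})"
proof
  fix x assume x: "x \<in> P"
  show "x \<in> (\<Union>(a, b)\<in>set (zip vs (tl vs)). convex hull {0, a, b})"
  proof (cases "x = 0")
    case True
    obtain a b ws where "vs = a # b # ws"
      using len by (metis One_nat_def Suc_1 Suc_le_length_iff)
    then show ?thesis
      using True by (auto simp: hull_inc)
  next
    case False
    then obtain t where t: "0 < t" "t *\<^sub>R x \<in> path_image (polygonal_chain vs)"
      using ray by blast
    then obtain a b where ab: "(a, b) \<in> set (zip vs (tl vs))" "t *\<^sub>R x \<in> closed_segment a b"
      using len by (auto simp: path_image_polygonal_chain)
    have "\<not> t < 1"
      using out[OF t(2), of "1 / t"] t(1) x by auto
    then have "(1 - 1 / t) *\<^sub>R 0 + (1 / t) *\<^sub>R (t *\<^sub>R x) \<in> convex hull {0, a, b}"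
      using ab(2) hull_mono[of "{a, b}" "{0, a, b}" convex] t(1)
      by (intro convexD[OF convex_convex_hull]) (auto simp: segment_convex_hull hull_inc)
    then show ?thesis
      using ab t by auto
  qed
qed

text \<open>An upper bound on the area suffices for a lower bound on the ratio, so subadditivity is
  enough and overlaps need no study. Measurability is carried along in the induction.\<close>

lemma measure_fan_le:
  "(\<Union>(a, b)\<in>set (zip vs (tl vs)). convex hull {0, a, b}) \<in> lmeasurable \<and>
   measure lebesgue (\<Union>(a, b)\<in>set (zip vs (tl vs)). convex hull {0, a, b})
     \<le> sum_list (map2 (\<lambda>a b. \<bar>crs a b\<bar> / 2) vs (tl vs))" (is "?U vs \<in> _ \<and> _")
proof (induction vs rule: induct_list012)
  case (3 a b vs)
  have T: "compact (convex hull {0, a, b})"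
    by (simp add: finite_imp_compact_convex_hull)
  have "measure lebesgue (convex hull {0, a, b}) = \<bar>crs a b\<bar> / 2"
    using T by (simp add: compact_imp_closed measure_completion content_triangle crs_def
        abs_minus_commute mult.commute)
  moreover have "measure lebesgue (convex hull {0, a, b} \<union> ?U (b # vs))
      \<le> measure lebesgue (convex hull {0, a, b}) + measure lebesgue (?U (b # vs))"
    using T 3 by (intro measure_Un_le) (auto simp: lmeasurable_compact fmeasurableD)
  ultimately show ?case
    using T 3 by (auto simp: lmeasurable_compact intro!: fmeasurable.Un)
qed auto

subsection \<open>The four triangles\<close>

definition rot :: "real^2 \<Rightarrow> real^2" where
  "rot p = vector [- p$2, p$1]"

lemma rot_nth [simp]: "rot p $ 1 = - p$2" "rot p $ 2 = p$1"
  by (simp_all add: rot_def)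

lemma vec2_eq_iff: "p = q \<longleftrightarrow> p$1 = q$1 \<and> p$2 = q$2" for p q :: "real^2"
  by (simp add: vec_eq_iff forall_2)

lemma linear_rot: "linear rot"
  by (rule linearI) (simp_all add: vec2_eq_iff)

lemma inj_rot: "inj rot"
  by (auto simp: inj_def vec2_eq_iff)

lemma rot_rot_rot_rot: "rot (rot (rot (rot p))) = p"
  by (simp add: vec2_eq_iff)

text \<open>The inverse of a quarter turn is its cube; this reduces membership in the rotated
  triangles to the inequalities of \<open>tri\<close>.\<close>

lemma mem_rot_image_iff: "p \<in> rot ` S \<longleftrightarrow> rot (rot (rot p)) \<in> S"
  by (metis image_iff rot_rot_rot_rot)

lemma crs_rot: "crs (rot a) (rot b) = crs a b"
  by (simp add: crs_def)

lemma dist_vec2: "dist a b = sqrt ((a$1 - b$1)\<^sup>2 + (a$2 - b$2)\<^sup>2)" for a b :: "real^2"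
  by (simp add: dist_vec_def L2_set_def UNIV_2 dist_real_def)

lemma dist_rot: "dist (rot a) (rot b) = dist a b"
  by (simp add: dist_vec2 power2_eq_square algebra_simps)

lemma dist_vec2_eqI:
  fixes a b :: "real^2"
  assumes "(a$1 - b$1)\<^sup>2 + (a$2 - b$2)\<^sup>2 = d\<^sup>2" "0 \<le> d"
  shows "dist a b = d"
  using assms by (simp add: dist_vec2)

lemma regular_triangle_rot:
  assumes "regular_triangle s T"
  shows "regular_triangle s (rot ` T)"
proof -
  obtain a b c where abc: "0 < s" "dist a b = s" "dist b c = s" "dist c a = s"
      "T = convex hull {a, b, c}"
    using assms by (auto simp: regular_triangle_def)
  have "rot ` T = convex hull {rot a, rot b, rot c}"
    by (simp add: abc(5) convex_hull_linear_image[OF linear_rot])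
  with abc(1-4) show ?thesis
    unfolding regular_triangle_def by (metis dist_rot)
qed

abbreviation halfplane :: "real \<Rightarrow> real \<Rightarrow> real \<Rightarrow> (real^2) set" where
  "halfplane c \<alpha> \<beta> \<equiv> {x. c \<le> \<alpha> * x$1 + \<beta> * x$2}"

lemma convex_halfplane: "convex (halfplane c \<alpha> \<beta>)"
proof -
  have "halfplane c \<alpha> \<beta> = {x. vector [\<alpha>, \<beta>] \<bullet> x \<ge> c}"
    by (simp add: inner_vec_def UNIV_2)
  then show ?thesis by (simp add: convex_halfspace_ge)
qed

text \<open>The centre is (- sqrt 3 / 30, 0). By threefold symmetry, the quarter turns 0, 90, 180,
  270 degrees act on the orientation of the triangle as 0, 90, 60, 30.\<close>

definition tri :: "(real^2) set" where
  "tri = convex hull {vector [3 * sqrt 3 / 10, 0], vector [- sqrt 3 / 5, 1/2], vector [- sqrt 3 / 5, - 1/2]}"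

lemma regular_triangle_tri: "regular_triangle 1 tri"
  unfolding regular_triangle_def tri_def
proof (intro conjI exI)
  show "dist (vector [3 * sqrt 3 / 10, 0] :: real^2) (vector [- sqrt 3 / 5, 1/2]) = 1"
    "dist (vector [- sqrt 3 / 5, 1/2] :: real^2) (vector [- sqrt 3 / 5, - 1/2]) = 1"
    "dist (vector [- sqrt 3 / 5, - 1/2] :: real^2) (vector [3 * sqrt 3 / 10, 0]) = 1"
    by (rule dist_vec2_eqI; simp add: power2_eq_square algebra_simps)+
qed simp_all

lemma mem_tri_iff:
  "p \<in> tri \<longleftrightarrow> - sqrt 3 / 5 \<le> p$1 \<and> p$1 + sqrt 3 * p$2 \<le> 3 * sqrt 3 / 10 \<and>
    p$1 - sqrt 3 * p$2 \<le> 3 * sqrt 3 / 10" (is "_ \<longleftrightarrow> ?H p")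
proof
  have "{p. ?H p} = halfplane (- sqrt 3 / 5) 1 0 \<inter> halfplane (- (3 * sqrt 3 / 10)) (- 1) (- sqrt 3) \<inter>
      halfplane (- (3 * sqrt 3 / 10)) (- 1) (sqrt 3)"
    by auto
  then have "convex {p. ?H p}"
    by (simp only: convex_Int convex_halfplane)
  then have "tri \<subseteq> {p. ?H p}"
    unfolding tri_def by (intro hull_minimal) auto
  then show "p \<in> tri \<Longrightarrow> ?H p" by auto
next
  assume H: "?H p"
  \<comment> \<open>Barycentric coordinates: distances to the edge lines divided by the height sqrt
    3 / 2.\<close>
  define u where "u = 2 / 5 + 2 / sqrt 3 * p$1"
  define v where "v = 3 / 10 - 1 / sqrt 3 * p$1 + p$2"
  define w where "w = 3 / 10 - 1 / sqrt 3 * p$1 - p$2"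
  have "u + v + w = 1"
    by (simp add: u_def v_def w_def)
  moreover have "0 \<le> u" "0 \<le> v" "0 \<le> w"
    using H by (auto simp: u_def v_def w_def field_simps)
  moreover have "p = u *\<^sub>R vector [3 * sqrt 3 / 10, 0] + v *\<^sub>R vector [- sqrt 3 / 5, 1/2] +
      w *\<^sub>R vector [- sqrt 3 / 5, - 1/2]"
    by (simp add: u_def v_def w_def vec2_eq_iff field_simps)
  ultimately show "p \<in> tri"
    unfolding tri_def convex_hull_3 by blast
qed

definition star :: "(real^2) set" where
  "star = tri \<union> rot ` tri \<union> rot ` rot ` tri \<union> rot ` rot ` rot ` tri"

lemma rot_star: "rot ` star = star"
proof -
  have "rot ` rot ` rot ` rot ` tri = tri"
    by (simp add: image_image rot_rot_rot_rot)
  then show ?thesis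
    by (simp add: star_def image_Un Un_ac)
qed

lemma compact_star: "compact star"
proof -
  have "compact tri"
    by (simp add: tri_def finite_imp_compact_convex_hull)
  moreover have "continuous_on S rot" for S
    by (simp add: linear_continuous_on linear_conv_bounded_linear[symmetric] linear_rot)
  ultimately show ?thesis
    unfolding star_def by (intro compact_Un compact_continuous_image)
qed

lemma scale_less:
  fixes t e h :: real
  assumes "0 \<le> t" "t < 1" "e \<le> h" "0 < h"
  shows "t * e < h"
proof (cases "0 < e")
  case True
  then have "t * e < 1 * e" using assms by (intro mult_strict_right_mono)
  then show ?thesis using assms by simp
next
  case False
  then have "t * e \<le> 0" using assms by (simp add: mult_nonneg_nonpos)
  then show ?thesis using assms by simp
qed

text \<open>The origin satisfies the three inequalities of \<open>tri\<close> strictly, so shrinking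
  towards it makes them strict; \<open>rot\<close> transfers this to the other triangles.\<close>

lemma scale_mem_interior_star:
  assumes "x \<in> star" "0 \<le> t" "t < 1"
  shows "t *\<^sub>R x \<in> interior star"
proof -
  have tri: "t *\<^sub>R y \<in> interior star" if "y \<in> tri" for y
  proof -
    let ?U = "{p :: real^2. - sqrt 3 / 5 < p$1 \<and> p$1 + sqrt 3 * p$2 < 3 * sqrt 3 / 10 \<and>
      p$1 - sqrt 3 * p$2 < 3 * sqrt 3 / 10}"
    have "open ?U"
      by (intro open_Collect_conj open_Collect_less continuous_intros)
    moreover have "?U \<subseteq> star"
      by (auto simp: star_def mem_tri_iff)
    ultimately have "?U \<subseteq> interior star"
      by (simp add: interior_maximal)
    moreover have "t *\<^sub>R y \<in> ?U"
      using that scale_less[OF assms(2,3), of "- y$1" "sqrt 3 / 5"]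
        scale_less[OF assms(2,3), of "y$1 + sqrt 3 * y$2" "3 * sqrt 3 / 10"]
        scale_less[OF assms(2,3), of "y$1 - sqrt 3 * y$2" "3 * sqrt 3 / 10"]
      by (simp add: mem_tri_iff algebra_simps)
    ultimately show ?thesis by blast
  qed
  have "rot ` interior star = interior star"
    using interior_injective_linear_image[OF linear_rot inj_rot, of star] by (simp add: rot_star)
  then have rot: "rot y \<in> interior star" if "y \<in> interior star" for y
    using that by blast
  have "t *\<^sub>R rot y = rot (t *\<^sub>R y)" for y
    by (simp add: vec2_eq_iff)
  then show ?thesis
    using assms(1) tri rot by (auto simp: star_def)
qed

text \<open>Each of the four conjuncts keeps a point out of the interior of one of the four triangles.
  The first quarter of the boundary lies beyond a single edge line of two of them, but beyond one
  of two edge lines, depending on the segment, for each of the others.\<close>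

definition outer :: "(real^2) set" where
  "outer = halfplane (3 * sqrt 3 / 10) 1 (sqrt 3) \<inter> halfplane (3 * sqrt 3 / 10) (sqrt 3) 1 \<inter>
     (halfplane (sqrt 3 / 5) 1 0 \<union> halfplane (3 * sqrt 3 / 10) (- 1) (sqrt 3)) \<inter>
     (halfplane (sqrt 3 / 5) 0 1 \<union> halfplane (3 * sqrt 3 / 10) (sqrt 3) (- 1))"

text \<open>All constants in \<open>outer\<close> are positive, so stretching makes its inequalities
  strict. Its conjuncts then exclude, in order, \<open>tri\<close> and its images under one, two and
  three quarter turns.\<close>

lemma scale_outer_notin_star:
  assumes "x \<in> outer" "1 < t"
  shows "t *\<^sub>R x \<notin> star"
proof -
  have *: "h < t * e" if "h \<le> e" "0 < h" for e h
  proof -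
    have "1 * e < t * e" using that assms(2) by (intro mult_strict_right_mono) auto
    with that show ?thesis by linarith
  qed
  define y where "y = t *\<^sub>R x"
  have y: "y$1 = t * x$1" "y$2 = t * x$2"
    by (simp_all add: y_def)
  have lin: "c < \<alpha> * y$1 + \<beta> * y$2" if "c \<le> \<alpha> * x$1 + \<beta> * x$2" "0 < c" for c \<alpha> \<beta>
    using *[OF that] by (simp add: y algebra_simps)
  have "3 * sqrt 3 / 10 < y$1 + sqrt 3 * y$2" "3 * sqrt 3 / 10 < sqrt 3 * y$1 + y$2"
    "sqrt 3 / 5 < y$1 \<or> 3 * sqrt 3 / 10 < - y$1 + sqrt 3 * y$2"
    "sqrt 3 / 5 < y$2 \<or> 3 * sqrt 3 / 10 < sqrt 3 * y$1 - y$2"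
    using assms(1) lin[of "3 * sqrt 3 / 10" 1 "sqrt 3"] lin[of "3 * sqrt 3 / 10" "sqrt 3" 1]
      lin[of "sqrt 3 / 5" 1 0] lin[of "sqrt 3 / 5" 0 1]
      lin[of "3 * sqrt 3 / 10" "- 1" "sqrt 3"] lin[of "3 * sqrt 3 / 10" "sqrt 3" "- 1"]
    by (auto simp: outer_def)
  then have "y \<notin> star"
    by (auto simp: star_def mem_rot_image_iff mem_tri_iff)
  then show ?thesis
    by (simp add: y_def)
qed

text \<open>What is asked of one boundary edge: it runs counterclockwise around the origin, and
  \<open>star\<close> ends there on every ray through it.\<close>

definition visible :: "real^2 \<Rightarrow> real^2 \<Rightarrow> bool" where
  "visible a b \<longleftrightarrow> 0 < crs a b \<and>
     (\<forall>x\<in>closed_segment a b. x \<in> star \<and> (\<forall>t>1. t *\<^sub>R x \<notin> star))"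

lemma visible_rot:
  assumes "visible a b" shows "visible (rot a) (rot b)"
proof -
  have star: "rot x \<in> star \<longleftrightarrow> x \<in> star" for x
    using rot_star inj_rot by (metis inj_image_mem_iff)
  have "t *\<^sub>R rot y = rot (t *\<^sub>R y)" for y t
    by (simp add: vec2_eq_iff)
  then show ?thesis
    using assms by (auto simp: visible_def crs_rot closed_segment_linear_image[OF linear_rot] star)
qed

text \<open>\<open>star\<close> and \<open>outer\<close> are not convex; choosing convex parts of
  them reduces the claim to the two endpoints.\<close>

lemma visibleI:
  assumes "0 < crs a b" "convex S" "S \<subseteq> star" "convex W" "W \<subseteq> outer" "{a, b} \<subseteq> S" "{a, b} \<subseteq> W"
  shows "visible a b"
proof -
  have "closed_segment a b \<subseteq> S" "closed_segment a b \<subseteq> W"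
    using assms by (simp_all add: closed_segment_subset)
  then have "closed_segment a b \<subseteq> star" "closed_segment a b \<subseteq> outer"
    using assms by auto
  then show ?thesis
    using assms(1) scale_outer_notin_star by (auto simp: visible_def)
qed

subsection \<open>The boundary\<close>

text \<open>Up to rotation these are all vertices of the boundary, in counterclockwise order; vB, vD
  and vF are the reflex ones.\<close>

definition vA :: "real^2" where "vA = vector [3 * sqrt 3 / 10, 0]"
definition vB :: "real^2" where "vB = vector [3 * (3 + sqrt 3) / 40, 3 * (3 - sqrt 3) / 40]"
definition vC :: "real^2" where "vC = vector [1/2, sqrt 3 / 5]"
definition vD :: "real^2" where "vD = vector [sqrt 3 / 5, sqrt 3 / 5]"
definition vE :: "real^2" where "vE = vector [sqrt 3 / 5, 1/2]"
definition vF :: "real^2" where "vF = vector [3 * (3 - sqrt 3) / 40, 3 * (3 + sqrt 3) / 40]"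

lemma vertex_nth [simp]:
  "vA $ 1 = 3 * sqrt 3 / 10" "vA $ 2 = 0"
  "vB $ 1 = 3 * (3 + sqrt 3) / 40" "vB $ 2 = 3 * (3 - sqrt 3) / 40"
  "vC $ 1 = 1/2" "vC $ 2 = sqrt 3 / 5"
  "vD $ 1 = sqrt 3 / 5" "vD $ 2 = sqrt 3 / 5"
  "vE $ 1 = sqrt 3 / 5" "vE $ 2 = 1/2"
  "vF $ 1 = 3 * (3 - sqrt 3) / 40" "vF $ 2 = 3 * (3 + sqrt 3) / 40"
  by (simp_all add: vA_def vB_def vC_def vD_def vE_def vF_def)

lemma sqrt3_bounds: "17 / 10 < sqrt 3" "sqrt 3 < 7 / 4"
  by (rule real_less_rsqrt real_less_lsqrt; simp add: power2_eq_square)+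

lemma sqrt3_mult: "sqrt 3 * (sqrt 3 * x) = 3 * x"
  by (simp flip: mult.assoc)

lemma star_parts:
  "tri \<subseteq> star" "rot ` tri \<subseteq> star" "rot ` rot ` tri \<subseteq> star" "rot ` rot ` rot ` tri \<subseteq> star"
  by (auto simp: star_def)

lemma convex_tri: "convex tri"
  by (simp add: tri_def)

lemma convex_rot_image: "convex S \<Longrightarrow> convex (rot ` S)"
  by (simp add: convex_linear_image linear_rot)

lemma visible_quarter:
  "visible vA vB" "visible vB vC" "visible vC vD" "visible vD vE" "visible vE vF" "visible vF (rot vA)"
proof -
  let ?h = "3 * sqrt 3 / 10" and ?w = "sqrt 3 / 5"
  let ?O = "halfplane ?h 1 (sqrt 3) \<inter> halfplane ?h (sqrt 3) 1"
  \<comment> \<open>Each set selects one alternative in each of the two disjunctions of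
    \<open>outer\<close>, which makes it convex.\<close>
  let ?X = "?O \<inter> (halfplane ?w 1 0 \<inter> halfplane ?h (sqrt 3) (- 1))"
  let ?Y = "?O \<inter> (halfplane ?w 1 0 \<inter> halfplane ?w 0 1)"
  let ?Z = "?O \<inter> (halfplane ?h (- 1) (sqrt 3) \<inter> halfplane ?w 0 1)"
  have cvx: "convex ?X" "convex ?Y" "convex ?Z"
    by (simp_all only: convex_Int convex_halfplane)
  have sub: "?X \<subseteq> outer" "?Y \<subseteq> outer" "?Z \<subseteq> outer"
    unfolding outer_def by blast+
  have cvx_tri: "convex tri" "convex (rot ` tri)" "convex (rot ` rot ` tri)" "convex (rot ` rot ` rot ` tri)"
    by (simp_all add: convex_tri convex_rot_image)
  note nums = crs_def mem_rot_image_iff mem_tri_iff field_simps sqrt3_mult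
  show "visible vA vB"
    by (rule visibleI[OF _ cvx_tri(1) star_parts(1) cvx(1) sub(1)];
        use sqrt3_bounds in \<open>simp add: nums\<close>)
  show "visible vB vC"
    by (rule visibleI[OF _ cvx_tri(4) star_parts(4) cvx(1) sub(1)];
        use sqrt3_bounds in \<open>simp add: nums\<close>)
  show "visible vC vD"
    by (rule visibleI[OF _ cvx_tri(4) star_parts(4) cvx(2) sub(2)];
        use sqrt3_bounds in \<open>simp add: nums\<close>)
  show "visible vD vE"
    by (rule visibleI[OF _ cvx_tri(3) star_parts(3) cvx(2) sub(2)];
        use sqrt3_bounds in \<open>simp add: nums\<close>)
  show "visible vE vF"
    by (rule visibleI[OF _ cvx_tri(3) star_parts(3) cvx(3) sub(3)];
        use sqrt3_bounds in \<open>simp add: nums\<close>)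
  show "visible vF (rot vA)"
    by (rule visibleI[OF _ cvx_tri(2) star_parts(2) cvx(3) sub(3)];
        use sqrt3_bounds in \<open>simp add: nums\<close>)
qed


definition chain_vertices :: "(real^2) list" where
  "chain_vertices =
     (let q = [vA, vB, vC, vD, vE, vF] in
      q @ map rot q @ map (rot \<circ> rot) q @ map (rot \<circ> rot \<circ> rot) q @ [vA])"

text \<open>The last vertex is written as a fourfold rotation so that every edge is literally a
  rotated copy of one of the six in \<open>visible_quarter\<close>.\<close>

lemma chain_vertices_eq:
  "chain_vertices = [vA, vB, vC, vD, vE, vF, rot vA, rot vB, rot vC, rot vD, rot vE, rot vF,
     rot (rot vA), rot (rot vB), rot (rot vC), rot (rot vD), rot (rot vE), rot (rot vF),
     rot (rot (rot vA)), rot (rot (rot vB)), rot (rot (rot vC)), rot (rot (rot vD)),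
     rot (rot (rot vE)), rot (rot (rot vF)), rot (rot (rot (rot vA)))]"
  by (simp add: chain_vertices_def rot_rot_rot_rot)

lemma chain_vertices_closed:
  "hd chain_vertices = last chain_vertices" "2 \<le> length chain_vertices"
  by (simp_all add: chain_vertices_def)

lemma visible_chain_vertices:
  "\<forall>(a, b)\<in>set (zip chain_vertices (tl chain_vertices)). visible a b"
  by (simp add: chain_vertices_eq visible_quarter visible_rot)

lemma simple_closed_chain_vertices: "simple_closed_chain chain_vertices"
proof -
  \<comment> \<open>The cuts at \<open>vA\<close>, \<open>rot vC\<close> and
    \<open>rot (rot vE)\<close> lie at about 0, 125 and 235 degrees, so each piece turns by less
    than a half turn.\<close>
  have "simple_closed_chain (vA # vB # [vC, vD, vE, vF, rot vA, rot vB] @ rot vC #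
      [rot vD, rot vE, rot vF, rot (rot vA), rot (rot vB), rot (rot vC), rot (rot vD)] @ rot (rot vE) #
      [rot (rot vF), rot (rot (rot vA)), rot (rot (rot vB)), rot (rot (rot vC)), rot (rot (rot vD)),
       rot (rot (rot vE)), rot (rot (rot vF))] @ [vA])"
    by (rule simple_closed_chain_crs_sorted;
        use sqrt3_bounds in \<open>simp add: crs_def field_simps sqrt3_mult\<close>)
  then show ?thesis
    by (simp add: chain_vertices_eq rot_rot_rot_rot)
qed

lemma ray_meets_chain:
  assumes "x \<noteq> 0"
  shows "\<exists>t>0. t *\<^sub>R x \<in> path_image (polygonal_chain chain_vertices)"
proof -
  \<comment> \<open>\<open>vA\<close> and its opposite vertex provide both signs, as the cyclic sign
    change requires.\<close>
  have opp: "crs (rot (rot vA)) x = - crs vA x"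
    by (simp add: crs_def)
  have "\<exists>u\<in>set chain_vertices. 0 \<le> crs u x" "\<exists>w\<in>set chain_vertices. crs w x \<le> 0"
    using opp by (cases "0 \<le> crs vA x"; auto simp: chain_vertices_eq)+
  then obtain u w where "u \<in> set chain_vertices" "0 \<le> crs u x" "w \<in> set chain_vertices" "crs w x \<le> 0"
    by blast
  then obtain p q where pq: "(p, q) \<in> set (zip chain_vertices (tl chain_vertices))"
      "0 \<le> crs p x" "crs q x \<le> 0"
    using sign_change_zip[of chain_vertices u "\<lambda>v. crs v x" w] chain_vertices_closed by blast
  moreover have "0 < crs p q"
    using pq(1) visible_chain_vertices by (auto simp: visible_def)
  ultimately obtain t where "0 < t" "t *\<^sub>R x \<in> closed_segment p q"
    using assms ray_meets_segment by blast
  with pq(1) show ?thesis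
    by (auto simp: path_image_polygonal_chain chain_vertices_closed)
qed

lemma chain_visible:
  assumes "x \<in> path_image (polygonal_chain chain_vertices)"
  shows "x \<in> star" "1 < t \<Longrightarrow> t *\<^sub>R x \<notin> star"
proof -
  obtain a b where "(a, b) \<in> set (zip chain_vertices (tl chain_vertices))"
      "x \<in> closed_segment a b"
    using assms by (auto simp: path_image_polygonal_chain chain_vertices_closed)
  then show "x \<in> star" "1 < t \<Longrightarrow> t *\<^sub>R x \<notin> star"
    using visible_chain_vertices by (auto simp: visible_def)
qed

lemma polygon_star: "polygon_with_boundary star chain_vertices"
  using compact_star simple_closed_chain_vertices scale_mem_interior_star chain_visible ray_meets_chain
  by (intro polygon_with_boundary_if_radial) auto

section \<open>Perimeter and area\<close>

lemma chain_length_star: "chain_length chain_vertices = 12 - 4 * sqrt 3"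
proof -
  \<comment> \<open>Swapping the coordinates reverses the quarter chain, so only three lengths
    occur, each eight times in all.\<close>
  have "dist vA vB = 3 * (3 - sqrt 3) / 20" "dist vF (rot vA) = 3 * (3 - sqrt 3) / 20"
    "dist vB vC = (11 - 3 * sqrt 3) / 20" "dist vE vF = (11 - 3 * sqrt 3) / 20"
    "dist vC vD = 1/2 - sqrt 3 / 5" "dist vD vE = 1/2 - sqrt 3 / 5"
    using sqrt3_bounds
    by (intro dist_vec2_eqI; simp add: power2_eq_square field_simps sqrt3_mult)+
  then show ?thesis
    by (simp add: chain_length_def chain_vertices_eq dist_rot field_simps)
qed

lemma measure_star_le: "measure lebesgue star \<le> sqrt 3 - 51 / 50"
proof -
  let ?U = "\<Union>(a, b)\<in>set (zip chain_vertices (tl chain_vertices)). convex hull {0, a, b}"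
  have "star \<subseteq> ?U"
    using chain_visible(2) ray_meets_chain
    by (intro radial_subset_fan) (auto simp: chain_vertices_closed)
  then have "measure lebesgue star \<le> measure lebesgue ?U"
    using measure_fan_le[of chain_vertices] compact_star
    by (intro measure_mono_fmeasurable) (auto simp: lmeasurable_compact fmeasurableD)
  also have "\<dots> \<le> sum_list (map2 (\<lambda>a b. \<bar>crs a b\<bar> / 2) chain_vertices (tl chain_vertices))"
    using measure_fan_le by blast
  also have "map2 (\<lambda>a b. \<bar>crs a b\<bar> / 2) chain_vertices (tl chain_vertices) =
      map2 (\<lambda>a b. crs a b / 2) chain_vertices (tl chain_vertices)"
    using visible_chain_vertices by (intro map_cong) (auto simp: visible_def)
  also have "sum_list (map2 (\<lambda>a b. crs a b / 2) chain_vertices (tl chain_vertices)) = sqrt 3 - 51 / 50"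
  proof -
    have "crs vA vB = 27 * (sqrt 3 - 1) / 400" "crs vF (rot vA) = 27 * (sqrt 3 - 1) / 400"
      "crs vB vC = 3 * (11 * sqrt 3 - 9) / 400" "crs vE vF = 3 * (11 * sqrt 3 - 9) / 400"
      "crs vC vD = sqrt 3 / 10 - 3 / 25" "crs vD vE = sqrt 3 / 10 - 3 / 25"
      by (simp_all add: crs_def field_simps sqrt3_mult)
    then show ?thesis
      by (simp add: chain_vertices_eq crs_rot field_simps)
  qed
  finally show ?thesis .
qed

text \<open>Needed besides the upper bound, since a quotient by 0 would be 0.\<close>

lemma measure_star_pos: "0 < measure lebesgue star"
proof -
  have tri: "compact tri"
    by (simp add: tri_def finite_imp_compact_convex_hull)
  have "0 < measure lborel tri"
    unfolding tri_def by (subst content_triangle) simp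
  also have "measure lborel tri = measure lebesgue tri"
    using tri by (simp add: compact_imp_closed measure_completion)
  also have "\<dots> \<le> measure lebesgue star"
    using tri compact_star star_parts(1)
    by (intro measure_mono_fmeasurable) (auto simp: lmeasurable_compact fmeasurableD)
  finally show ?thesis .
qed

text \<open>The vertex \<open>vA\<close> separates \<open>tri\<close> from the other three;
  injectivity of \<open>rot\<close> reduces the remaining pairs to this case.\<close>

lemma card_rot_tri: "card {tri, rot ` tri, rot ` rot ` tri, rot ` rot ` rot ` tri} = 4"
proof -
  have "vA \<in> tri" "vA \<notin> rot ` tri" "vA \<notin> rot ` rot ` tri" "vA \<notin> rot ` rot ` rot ` tri"
    using sqrt3_bounds by (simp_all add: mem_rot_image_iff mem_tri_iff field_simps)
  then have "tri \<noteq> rot ` tri" "tri \<noteq> rot ` rot ` tri" "tri \<noteq> rot ` rot ` rot ` tri"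
    by metis+
  then show ?thesis
    by (simp add: inj_image_eq_iff[OF inj_rot])
qed

theorem theorem2p8:
  shows "\<exists>(P :: (real^2) set) (F :: (real^2) set set) (vs :: (real^2) list).
    card F = 4 \<and> (\<forall>T\<in>F. regular_triangle 1 T) \<and> P = \<Union>F \<and>
    polygon_with_boundary P vs \<and>
    chain_length vs / measure lebesgue P > 4 * sqrt 3"
proof (intro exI conjI)
  let ?F = "{tri, rot ` tri, rot ` rot ` tri, rot ` rot ` rot ` tri}"
  show "card ?F = 4"
    by (rule card_rot_tri)
  show "\<forall>T\<in>?F. regular_triangle 1 T"
    by (simp add: regular_triangle_tri regular_triangle_rot)
  show "star = \<Union>?F"
    by (auto simp: star_def)
  show "polygon_with_boundary star chain_vertices"
    by (rule polygon_star)
  \<comment> \<open>The bound equals 12 - (102/25) sqrt 3, which is below the perimeter by 2 sqrt 3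
    / 25.\<close>
  have "4 * sqrt 3 * measure lebesgue star \<le> 4 * sqrt 3 * (sqrt 3 - 51 / 50)"
    by (intro mult_left_mono measure_star_le) simp
  also have "\<dots> < chain_length chain_vertices"
    by (simp add: chain_length_star algebra_simps sqrt3_mult)
  finally show "4 * sqrt 3 < chain_length chain_vertices / measure lebesgue star"
    by (simp add: measure_star_pos pos_less_divide_eq)
qed

end
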